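(* Let $\overline{\overline{G}}_n=\prod_{b=2}^n b^{\overline{\nu}(n,b)}$. Then for all integers $n\ge 2$, $$\log\overline{\overline{G}}_n=\frac{1}{2}n^2\log n+\left(\frac{1}{2}\gamma-\frac{3}{4}\right)n^2+O\left(n^{3/2}\log n\right),$$ where $\gamma$ is Euler's constant.
   Context: For integers $b\ge 2$ and $n\ge 1$, $d_b(n)$ denotes the sum of the base-$b$ digits of $n$, and $S_b(n):=\sum_{j=1}^{n-1}d_b(j)$. Define $$\overline{\nu}(n,b):=\frac{2}{b-1}S_b(n)-\frac{n-1}{b-1}d_b(n).$$ The constant implied by the $O$-notation is absolute. *)

theory Defs
  imports "HOL-Analysis.Analysis"
begin

text \<open>Sum of the base-\<open>b\<close> digits of \<open>n\<close>. The guard \<open>b < 2\<close> is only there for termination; the value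
  in that case is meaningless.\<close>
fun digit_sum :: "nat \<Rightarrow> nat \<Rightarrow> nat" where
  "digit_sum b n = (if n = 0 \<or> b < 2 then 0 else n mod b + digit_sum b (n div b))"

declare digit_sum.simps [simp del]

definition digit_sum_total :: "nat \<Rightarrow> nat \<Rightarrow> nat" where
  "digit_sum_total b n = (\<Sum>j\<in>{1..<n}. digit_sum b j)"

definition nu_bar :: "nat \<Rightarrow> nat \<Rightarrow> real" where
  "nu_bar n b = 2 / (real b - 1) * real (digit_sum_total b n)
     - (real n - 1) / (real b - 1) * real (digit_sum b n)"

definition G_bar_bar :: "nat \<Rightarrow> real" where
  "G_bar_bar n = (\<Prod>b\<in>{2..n}. real b powr nu_bar n b)"

end

theory Submission
  imports Defs "HOL-Library.Discrete_Functions"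
begin

text \<open>
  Legendre's digit formula writes \<open>nu_bar n b\<close> as the sum over \<open>i \<ge> 1\<close> of
  \<open>g(n, b^i)\<close> with \<open>g(n, m) = q (m (q + 1) - (n + 1))\<close>, \<open>q = n div m\<close>, and
  \<open>0 \<le> g(n, m) \<le> n\<close>. The terms \<open>i \<ge> 2\<close> only occur for \<open>b \<le> sqrt n\<close>
  and contribute \<open>O(n^(3/2) log n)\<close>. The terms \<open>i = 1\<close> add up to the sum of
  \<open>log b (2bk - (n + 1))\<close> over the pairs with \<open>bk \<le> n\<close>; by the symmetry of \<open>b\<close>
  and \<open>k\<close> one may replace \<open>log b\<close> by half of \<open>log (bk)\<close>. What is left are sums of a
  monotone function of \<open>bk\<close>, which follow by partial summation from Dirichlet's estimate
  \<open>n log n + (2\<gamma> - 1) n + O(sqrt n)\<close> for the number of pairs.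
\<close>

section \<open>Digit sums and Legendre's formula\<close>

text \<open>Closed form of \<open>(n - 1) * (n div m)\<close> minus twice the sum of
  \<open>j div m\<close> over \<open>j < n\<close>. It is also the sum of the arithmetic progression
  \<open>2 * m * k - (n + 1)\<close> over \<open>1 \<le> k \<le> n div m\<close>.\<close>

definition legendre_term :: "nat \<Rightarrow> nat \<Rightarrow> real" where
  "legendre_term n m = real (n div m) * (real m * (real (n div m) + 1) - (real n + 1))"

text \<open>Removing the last digit replaces \<open>n\<close> by \<open>n div b\<close>, which
  shifts the quotients \<open>n div b ^ i\<close> by one index. Quotients beyond \<open>N\<close>
  vanish, so one \<open>N\<close> serves a whole range of \<open>n\<close>.\<close>

lemma digit_sum_eq_sum_div:
  assumes "b \<ge> 2" "n < b ^ Suc N"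
  shows "real (digit_sum b n) = real n - (real b - 1) * (\<Sum>i=1..N. real (n div b ^ i))"
  using assms(2)
proof (induction N arbitrary: n)
  case 0
  then show ?case
    using assms(1) by (simp add: digit_sum.simps[of b n] digit_sum.simps[of b 0])
next
  case (Suc N)
  show ?case
  proof (cases "n = 0")
    case True
    then show ?thesis by (simp add: digit_sum.simps[of b 0])
  next
    case False
    have "n div b < b ^ Suc N"
      using Suc.prems assms(1) by (simp add: less_mult_imp_div_less mult.commute)
    note IH = Suc.IH[OF this]
    have "(\<Sum>i=1..Suc N. real (n div b ^ i)) = real (n div b) + (\<Sum>i=1..N. real (n div b div b ^ i))"
      by (simp add: sum.atLeast_Suc_atMost[of 0 N] sum.shift_bounds_cl_Suc_ivl div_mult2_eq
          del: sum.cl_ivl_Suc)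
    moreover have "real (digit_sum b n) = real (n mod b) + real (digit_sum b (n div b))"
      using False assms(1) by (simp add: digit_sum.simps[of b n])
    moreover have "real (n mod b) = real n - real b * real (n div b)"
      by (metis add_diff_cancel_left' mult_div_mod_eq of_nat_add of_nat_mult)
    ultimately show ?thesis using IH by (simp add: algebra_simps)
  qed
qed

text \<open>By induction on \<open>n\<close>: the quotient grows only when \<open>m\<close> divides
  \<open>Suc n\<close>, and then the product term grows by
  \<open>2 * m * (n div m + 1) = 2 * Suc n\<close>. The arrangement avoids subtraction of
  naturals.\<close>

lemma sum_div_lessThan:
  fixes m n :: nat
  assumes "m \<ge> 1"
  shows "2 * (\<Sum>j<n. j div m) + m * (n div m) * (n div m + 1) = 2 * n * (n div m)"
proof (induction n)
  case (Suc n)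
  show ?case
  proof (cases "Suc n mod m = 0")
    case True
    then have *: "Suc n div m = Suc (n div m)" by (simp add: div_Suc)
    have M: "m * Suc (n div m) = Suc n" using True * by (metis add.right_neutral mult_div_mod_eq)
    have "m * (Suc (n div m)) * (Suc (n div m) + 1)
        = m * (n div m) * (n div m + 1) + 2 * (m * Suc (n div m))"
      by (simp add: algebra_simps)
    then have "m * (Suc (n div m)) * (Suc (n div m) + 1) = m * (n div m) * (n div m + 1) + 2 * Suc n"
      unfolding M .
    then show ?thesis using Suc * by (simp add: algebra_simps)
  next
    case False
    then have *: "Suc n div m = n div m" by (simp add: div_Suc)
    then show ?thesis using Suc by (simp add: algebra_simps)
  qed
qed auto

lemma legendre_term_eq:
  assumes "m \<ge> 1" "n \<ge> 1"
  shows "legendre_term n m = (real n - 1) * real (n div m) - 2 * (\<Sum>j\<in>{1..<n}. real (j div m))"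
proof -
  have "(\<Sum>j<n. j div m) = (\<Sum>j\<in>{1..<n}. j div m)"
    using assms(2) by (simp add: lessThan_atLeast0 sum.atLeast_Suc_lessThan)
  with sum_div_lessThan[OF assms(1), of n]
  have "2 * (\<Sum>j\<in>{1..<n}. j div m) + m * (n div m) * (n div m + 1) = 2 * n * (n div m)"
    by simp
  then have "real (2 * (\<Sum>j\<in>{1..<n}. j div m) + m * (n div m) * (n div m + 1)) = real (2 * n * (n div m))"
    by (rule arg_cong)
  then show ?thesis
    unfolding legendre_term_def by (simp add: algebra_simps)
qed

text \<open>With \<open>q = n div m\<close>, the lower bound is \<open>n < m * (q + 1)\<close>. For
  the upper one, \<open>m * q \<le> n\<close> bounds the bracket by \<open>m - 1\<close>, and
  \<open>q * (m - 1) \<le> n\<close>.\<close>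

lemma legendre_term_bounds:
  assumes "m \<ge> 1"
  shows "0 \<le> legendre_term n m" "legendre_term n m \<le> real n"
proof -
  define q where "q = real (n div m)"
  have q: "q \<ge> 0" unfolding q_def by simp
  have "n + 1 \<le> m * (n div m + 1)"
    using dividend_less_times_div[of m n] assms by simp
  then have "real (n + 1) \<le> real (m * (n div m + 1))" by (simp only: of_nat_le_iff)
  then have 1: "real n + 1 \<le> real m * (q + 1)" unfolding q_def by (simp add: algebra_simps)
  show "0 \<le> legendre_term n m"
    unfolding legendre_term_def q_def[symmetric] using 1 q by simp
  have "m * (n div m) \<le> n" by simp
  then have "real (m * (n div m)) \<le> real n" by (simp only: of_nat_le_iff)
  then have 2: "real m * q \<le> real n" unfolding q_def by simp
  have "legendre_term n m \<le> q * (real m - 1)"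
    unfolding legendre_term_def q_def[symmetric]
    by (rule mult_left_mono) (use 2 q in \<open>auto simp: algebra_simps\<close>)
  also have "\<dots> \<le> real n" using 2 q by (simp add: algebra_simps)
  finally show "legendre_term n m \<le> real n" .
qed

lemma nu_bar_eq_sum_legendre_term:
  assumes "b \<ge> 2" "n \<ge> 1"
  shows "nu_bar n b = (\<Sum>i=1..n. legendre_term n (b ^ i))"
proof -
  \<comment> \<open>This makes the range \<open>1..n\<close> of exponents sufficient for every
    \<open>j \<le> n\<close> at once.\<close>
  have n: "n < b ^ Suc n"
    using assms(1) less_exp[of "Suc n"] power_mono[of 2 b "Suc n"] by linarith
  define c where "c = real b - 1"
  have c: "c \<noteq> 0" using assms(1) unfolding c_def by simp
  have D: "real (digit_sum b j) = real j - c * (\<Sum>i=1..n. real (j div b ^ i))" if "j \<le> n" for j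
    unfolding c_def by (rule digit_sum_eq_sum_div) (use assms n that in auto)
  have "(\<Sum>j\<in>{1..<Suc k}. real j) = real (Suc k) * (real (Suc k) - 1) / 2" for k
    by (induction k) (simp_all add: field_simps)
  from this[of "n - 1"] have S: "(\<Sum>j\<in>{1..<n}. real j) = real n * (real n - 1) / 2"
    using assms(2) by (metis Suc_diff_1 Suc_le_eq One_nat_def)
  have "real (digit_sum_total b n) = (\<Sum>j\<in>{1..<n}. real j - c * (\<Sum>i=1..n. real (j div b ^ i)))"
    unfolding digit_sum_total_def of_nat_sum by (rule sum.cong) (auto simp: D)
  also have "\<dots> = real n * (real n - 1) / 2 - c * (\<Sum>i=1..n. \<Sum>j\<in>{1..<n}. real (j div b ^ i))"
    by (subst sum.swap) (simp add: sum_subtractf S[unfolded One_nat_def] sum_distrib_left)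
  finally have T: "real (digit_sum_total b n) = \<dots>" .
  \<comment> \<open>The linear parts of the two digit formulas cancel: both contribute
    \<open>n * (n - 1) / c\<close>.\<close>
  have "nu_bar n b = (real n - 1) * (\<Sum>i=1..n. real (n div b ^ i))
      - 2 * (\<Sum>i=1..n. \<Sum>j\<in>{1..<n}. real (j div b ^ i))"
    unfolding nu_bar_def T D[OF order.refl] c_def[symmetric] using c by (simp add: field_simps)
  also have "\<dots> = (\<Sum>i=1..n. legendre_term n (b ^ i))"
    using assms by (simp add: legendre_term_eq sum_subtractf sum_distrib_left)
  finally show ?thesis .
qed

section \<open>Powers with exponent at least two\<close>

text \<open>Only exponents up to \<open>ln n / ln b\<close> give a nonzero quotient, and each such
  term is at most \<open>n\<close>; the weight \<open>ln b\<close> cancels the denominator. For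
  \<open>b\<close> above the square root of \<open>n\<close> every quotient is zero.\<close>

lemma sum_legendre_term_higher_powers:
  assumes "b \<ge> 2" "n \<ge> 1"
  shows "(\<Sum>i=2..n. legendre_term n (b ^ i)) * ln (real b) \<in> {0..real n * ln (real n)}"
    and "n < b\<^sup>2 \<Longrightarrow> (\<Sum>i=2..n. legendre_term n (b ^ i)) = 0"
proof -
  have lnb: "ln (real b) > 0" using assms by simp
  define K where "K = nat \<lfloor>ln (real n) / ln (real b)\<rfloor>"
  have z: "legendre_term n (b ^ i) = 0" if "n < b ^ i" for i
    using that by (simp add: legendre_term_def)
  have le: "legendre_term n (b ^ i) \<le> (if i \<in> {1..K} then real n else 0)" if "i \<in> {2..n}" for i
  proof (cases "n < b ^ i")
    case False
    then have "real (b ^ i) \<le> real n" by (simp only: of_nat_le_iff not_less)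
    then have "ln (real (b ^ i)) \<le> ln (real n)"
      using assms by (subst ln_le_cancel_iff) auto
    then have "real i * ln (real b) \<le> ln (real n)"
      using assms by (simp add: ln_realpow)
    then have "i \<le> K"
      unfolding K_def using lnb by (simp add: le_nat_floor pos_le_divide_eq)
    then show ?thesis using legendre_term_bounds[of "b ^ i" n] assms that by auto
  qed (simp add: z)
  have "(\<Sum>i=2..n. legendre_term n (b ^ i)) \<le> (\<Sum>i=2..n. (if i \<in> {1..K} then real n else 0))"
    by (rule sum_mono) (rule le)
  also have "\<dots> = real n * real (card ({2..n} \<inter> {1..K}))"
    by (subst sum.inter_restrict[symmetric]) auto
  also have "\<dots> \<le> real n * real K"
    using card_mono[of "{1..K}" "{2..n} \<inter> {1..K}"] by (intro mult_left_mono) auto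
  finally have up: "(\<Sum>i=2..n. legendre_term n (b ^ i)) * ln (real b) \<le> real n * real K * ln (real b)"
    using lnb by simp
  also have "real K \<le> ln (real n) / ln (real b)"
    unfolding K_def using lnb assms by (intro of_nat_floor) auto
  then have "real n * real K * ln (real b) \<le> real n * ln (real n)"
    using lnb assms by (simp add: pos_le_divide_eq mult.assoc)
  with up have "(\<Sum>i=2..n. legendre_term n (b ^ i)) * ln (real b) \<le> real n * ln (real n)"
    by (rule order.trans)
  moreover have "(\<Sum>i=2..n. legendre_term n (b ^ i)) \<ge> 0"
    by (rule sum_nonneg) (use legendre_term_bounds assms in auto)
  ultimately show "(\<Sum>i=2..n. legendre_term n (b ^ i)) * ln (real b) \<in> {0..real n * ln (real n)}"
    using lnb by simp
  assume n: "n < b\<^sup>2"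
  show "(\<Sum>i=2..n. legendre_term n (b ^ i)) = 0"
  proof (rule sum.neutral, rule ballI)
    fix i assume "i \<in> {2..n}"
    then have "b\<^sup>2 \<le> b ^ i" using assms by (intro power_increasing) auto
    then show "legendre_term n (b ^ i) = 0" using n by (intro z) simp
  qed
qed

text \<open>Only the bases up to the square root of \<open>n\<close> leave a remainder, each between
  0 and \<open>n * ln n\<close>.\<close>

lemma ln_G_bar_bar_approx:
  assumes "n \<ge> 1"
  shows "\<bar>ln (G_bar_bar n) - (\<Sum>b=1..n. ln (real b) * legendre_term n b)\<bar>
    \<le> real n * sqrt (real n) * ln (real n)"
proof -
  define R where "R b = (\<Sum>i=2..n. legendre_term n (b ^ i)) * ln (real b)" for b
  define u where "u = floor_sqrt n"
  have u: "real u \<le> sqrt (real n)"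
    unfolding u_def by (rule real_le_rsqrt) (metis floor_sqrt_power2_le of_nat_le_iff of_nat_power)
  have R0: "R b = 0" if "b \<in> {2..n}" "b \<notin> {1..u}" for b
  proof -
    have "n < b\<^sup>2" using that le_floor_sqrtI[of b n] unfolding u_def by fastforce
    then show ?thesis
      unfolding R_def using that sum_legendre_term_higher_powers(2)[of b n] by simp
  qed
  have Rb: "0 \<le> R b" "R b \<le> real n * ln (real n)" if "b \<in> {2..n}" for b
    using sum_legendre_term_higher_powers(1)[of b n] that assms unfolding R_def by auto
  have "ln (G_bar_bar n) = (\<Sum>b=2..n. nu_bar n b * ln (real b))"
    unfolding G_bar_bar_def by (subst ln_prod) auto
  also have "\<dots> = (\<Sum>b=2..n. ln (real b) * legendre_term n b + R b)"
  proof (rule sum.cong)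
    fix b assume b: "b \<in> {2..n}"
    then have "nu_bar n b = legendre_term n b + (\<Sum>i=2..n. legendre_term n (b ^ i))"
      by (simp add: nu_bar_eq_sum_legendre_term sum.atLeast_Suc_atMost[of "Suc 0"] numeral_2_eq_2)
    then show "nu_bar n b * ln (real b) = ln (real b) * legendre_term n b + R b"
      unfolding R_def by (simp add: algebra_simps)
  qed simp
  \<comment> \<open>The base 1 may be added because \<open>ln 1 = 0\<close>; the range then matches
    the lattice points below.\<close>
  also have "\<dots> = (\<Sum>b=1..n. ln (real b) * legendre_term n b) + (\<Sum>b=2..n. R b)"
    using assms by (simp add: sum.distrib sum.atLeast_Suc_atMost[of "Suc 0"] numeral_2_eq_2)
  finally have eq: "ln (G_bar_bar n) - (\<Sum>b=1..n. ln (real b) * legendre_term n b) = (\<Sum>b=2..n. R b)"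
    by simp
  have "(\<Sum>b=2..n. R b) \<le> (\<Sum>b=2..n. if b \<in> {1..u} then real n * ln (real n) else 0)"
    by (rule sum_mono) (use R0 Rb in \<open>simp split: if_splits\<close>)
  also have "\<dots> = real n * ln (real n) * real (card ({2..n} \<inter> {1..u}))"
    by (subst sum.inter_restrict[symmetric]) auto
  also have "\<dots> \<le> real n * ln (real n) * real u"
    using card_mono[of "{1..u}" "{2..n} \<inter> {1..u}"] assms by (intro mult_left_mono) auto
  also have "\<dots> \<le> real n * ln (real n) * sqrt (real n)"
    using u assms by (intro mult_left_mono) auto
  finally have "(\<Sum>b=2..n. R b) \<le> real n * sqrt (real n) * ln (real n)"
    by (simp add: mult_ac)
  moreover have "(\<Sum>b=2..n. R b) \<ge> 0" by (rule sum_nonneg) (use Rb in auto)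
  ultimately show ?thesis unfolding eq by simp
qed

section \<open>Lattice points under the hyperbola\<close>

text \<open>The cardinality is the summatory function of the number of divisors. The comprehension
  makes the symmetry in \<open>b\<close> and \<open>k\<close> visible.\<close>

definition hyperbola_pairs :: "nat \<Rightarrow> (nat \<times> nat) set" where
  "hyperbola_pairs n = {(b, k). 1 \<le> b \<and> 1 \<le> k \<and> b * k \<le> n}"

lemma hyperbola_pairs_eq_Sigma: "hyperbola_pairs n = (SIGMA b:{1..n}. {1..n div b})"
proof (intro set_eqI, clarify)
  fix b k :: nat
  have "b * 1 \<le> n" if "1 \<le> k" "b * k \<le> n"
    using that by (meson mult_le_mono2 order_trans)
  moreover have "k \<le> n div b \<longleftrightarrow> b * k \<le> n" if "1 \<le> b"
    using that by (simp add: less_eq_div_iff_mult_less_eq mult.commute)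
  ultimately show "(b, k) \<in> hyperbola_pairs n \<longleftrightarrow> (b, k) \<in> (SIGMA b:{1..n}. {1..n div b})"
    unfolding hyperbola_pairs_def by (cases "1 \<le> b"; cases "1 \<le> k") auto
qed

lemma finite_hyperbola_pairs [simp]: "finite (hyperbola_pairs n)"
  by (simp add: hyperbola_pairs_eq_Sigma)

lemma sum_hyperbola_pairs_swap:
  "(\<Sum>(b, k)\<in>hyperbola_pairs n. f b k) = (\<Sum>(b, k)\<in>hyperbola_pairs n. f k b)"
  by (rule sum.reindex_bij_witness[of _ prod.swap prod.swap])
    (auto simp: hyperbola_pairs_def mult.commute)

text \<open>The new pairs all have product \<open>Suc n\<close>, hence equal weight. Writing their
  number as a difference of counts prepares summation by parts.\<close>

lemma sum_hyperbola_pairs_Suc: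
  fixes w :: "nat \<Rightarrow> real"
  shows "(\<Sum>(b, k)\<in>hyperbola_pairs (Suc n). w (b * k)) = (\<Sum>(b, k)\<in>hyperbola_pairs n. w (b * k))
    + (real (card (hyperbola_pairs (Suc n))) - real (card (hyperbola_pairs n))) * w (Suc n)"
proof -
  have sub: "hyperbola_pairs n \<subseteq> hyperbola_pairs (Suc n)"
    by (auto simp: hyperbola_pairs_def)
  define Q where "Q = hyperbola_pairs (Suc n) - hyperbola_pairs n"
  have Q: "b * k = Suc n" if "(b, k) \<in> Q" for b k
    using that by (auto simp: Q_def hyperbola_pairs_def)
  have "real (card Q) = real (card (hyperbola_pairs (Suc n))) - real (card (hyperbola_pairs n))"
    unfolding Q_def using sub by (simp add: card_Diff_subset of_nat_diff card_mono)
  moreover have "(\<Sum>(b, k)\<in>Q. w (b * k)) = (\<Sum>p\<in>Q. w (Suc n))"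
    by (rule sum.cong) (auto simp: Q)
  moreover have "(\<Sum>(b, k)\<in>hyperbola_pairs (Suc n). w (b * k))
      = (\<Sum>(b, k)\<in>Q. w (b * k)) + (\<Sum>(b, k)\<in>hyperbola_pairs n. w (b * k))"
    unfolding Q_def by (rule sum.subset_diff[OF sub]) simp
  ultimately show ?thesis by simp
qed

section \<open>Dirichlet's divisor estimate\<close>

text \<open>The bounds on \<open>euler_mascheroni\<close> compare \<open>harm u\<close> with
  \<open>ln (u + 1)\<close>. Passing to \<open>ln u\<close> adds an error of the opposite sign, so
  \<open>1 / u\<close> covers both.\<close>

lemma harm_approx:
  assumes "u \<ge> 1"
  shows "\<bar>harm u - (ln (real u) + euler_mascheroni)\<bar> \<le> 1 / real u"
proof -
  have u: "real u > 0" using assms by simp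
  have "ln (real (Suc u)) - ln (real u) = ln (1 + 1 / real u)"
  proof -
    have "1 + 1 / real u = real (Suc u) / real u" using u by (simp add: field_simps)
    then show ?thesis using u by (simp add: ln_div)
  qed
  moreover have "ln (1 + 1 / real u) \<le> 1 / real u" "ln (1 + 1 / real u) \<ge> 0"
    using u by (auto intro: ln_add_one_self_le_self)
  moreover have "inverse (real (2 * (u + 1))) \<ge> 0" "inverse (real (2 * u)) \<le> 1 / real u"
    using u by (auto simp: field_simps)
  ultimately show ?thesis
    using euler_mascheroni_bounds[OF assms]
    unfolding abs_le_iff atLeastAtMost_iff by linarith
qed

definition dirichlet_main :: "real \<Rightarrow> real" where
  "dirichlet_main t = t * ln t + (2 * euler_mascheroni - 1) * t"

text \<open>Dirichlet's hyperbola method: with \<open>u = floor_sqrt n\<close>, every pair has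
  \<open>b \<le> u\<close> or \<open>k \<le> u\<close>. The two cases are mirror images and overlap
  in a square of side \<open>u\<close>.\<close>

lemma card_hyperbola_pairs_eq:
  "card (hyperbola_pairs n) + (floor_sqrt n)\<^sup>2 = 2 * (\<Sum>b=1..floor_sqrt n. n div b)"
proof -
  define u where "u = floor_sqrt n"
  define X where "X = (SIGMA b:{1..u}. {1..n div b})"
  have un: "u \<le> n" unfolding u_def by (rule floor_sqrt_le)
  have uu: "u * u \<le> n" using floor_sqrt_power2_le[of n] unfolding u_def by (simp add: power2_eq_square)
  have gt: "n < Suc u * Suc u" using Suc_floor_sqrt_power2_gt[of n] unfolding u_def by (simp add: power2_eq_square)
  have X: "X = {(b, k). 1 \<le> b \<and> 1 \<le> k \<and> b * k \<le> n \<and> b \<le> u}"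
    unfolding X_def by (auto simp: less_eq_div_iff_mult_less_eq mult.commute)
  have cX: "card X = (\<Sum>b=1..u. n div b)" unfolding X_def by simp
  have swap: "prod.swap ` X = {(b, k). 1 \<le> b \<and> 1 \<le> k \<and> b * k \<le> n \<and> k \<le> u}"
    unfolding X by (auto simp: mult.commute image_iff)
  have "card (prod.swap ` X) = card X" by (rule card_image) simp
  have "b \<le> u \<or> k \<le> u" if "b * k \<le> n" for b k
  proof (rule ccontr)
    assume "\<not> ?thesis"
    then have "Suc u * Suc u \<le> b * k" by (intro mult_le_mono) auto
    with gt that show False by simp
  qed
  then have un': "X \<union> prod.swap ` X = hyperbola_pairs n"
    unfolding swap unfolding X hyperbola_pairs_def by auto
  have "b * k \<le> n" if "b \<le> u" "k \<le> u" for b k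
    using mult_le_mono[OF that] uu by linarith
  then have "X \<inter> prod.swap ` X = {1..u} \<times> {1..u}"
    unfolding swap unfolding X by auto
  then have "card (X \<inter> prod.swap ` X) = u * u" by simp
  moreover have "finite X" unfolding X_def by simp
  ultimately show ?thesis
    using card_Un_Int[of X "prod.swap ` X"] \<open>card (prod.swap ` X) = card X\<close> un'
    unfolding u_def[symmetric] cX[symmetric] by (simp add: power2_eq_square)
qed

text \<open>Dropping the floors in the hyperbola identity costs at most 1 per term and leaves a
  harmonic sum; \<open>floor_sqrt n\<close> is then replaced by the true square root.\<close>

lemma dirichlet_divisor_bound:
  assumes "n \<ge> 1"
  shows "\<bar>real (card (hyperbola_pairs n)) - dirichlet_main (real n)\<bar> \<le> 20 * sqrt (real n)"
proof -
  define u where "u = floor_sqrt n"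
  define x where "x = real n"
  define v where "v = real u"
  define A where "A = (\<Sum>b=1..u. real (n div b))"
  have "u \<ge> 1" unfolding u_def using assms by (simp add: Suc_le_eq)
  then have v1: "v \<ge> 1" unfolding v_def by simp
  have x1: "x \<ge> 1" using assms unfolding x_def by simp
  have vx: "v\<^sup>2 \<le> x" unfolding v_def x_def u_def
    by (metis floor_sqrt_power2_le of_nat_le_iff of_nat_power)
  have "Suc n \<le> (Suc u)\<^sup>2" using Suc_floor_sqrt_power2_gt[of n] unfolding u_def by simp
  then have "real (Suc n) \<le> real ((Suc u)\<^sup>2)" by (simp only: of_nat_le_iff)
  then have "x + 1 \<le> (v + 1)\<^sup>2" unfolding v_def x_def by (simp add: add.commute)
  then have xv: "x \<le> v\<^sup>2 + 2 * v" by (simp add: power2_eq_square algebra_simps)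
  have "v * 1 \<le> v * v" using v1 by (intro mult_left_mono) auto
  \<comment> \<open>Errors of size \<open>x / v\<close> thereby become multiples of
    \<open>v\<close>.\<close>
  then have "x \<le> 3 * v * v" using xv unfolding power2_eq_square by linarith
  then have x3: "x / v \<le> 3 * v" using v1 by (simp add: pos_divide_le_eq)
  have "A - x * harm u = (\<Sum>b=1..u. real (n div b) - x / real b)"
    unfolding A_def harm_def sum_distrib_left sum_subtractf by (simp add: divide_inverse)
  also have "\<bar>\<dots>\<bar> \<le> (\<Sum>b=1..u. 1)"
  proof (rule order.trans[OF sum_abs], rule sum_mono)
    fix b assume b: "b \<in> {1..u}"
    have "real (n div b) = of_int \<lfloor>x / real b\<rfloor>" unfolding x_def by (simp add: floor_divide_of_nat_eq)
    then show "\<bar>real (n div b) - x / real b\<bar> \<le> 1" by linarith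
  qed
  finally have A: "\<bar>A - x * harm u\<bar> \<le> v" unfolding v_def by simp
  have H: "\<bar>x * harm u - x * (ln v + euler_mascheroni)\<bar> \<le> 3 * v"
  proof -
    have "\<bar>x * harm u - x * (ln v + euler_mascheroni)\<bar> = x * \<bar>harm u - (ln v + euler_mascheroni)\<bar>"
      using x1 by (simp add: abs_mult right_diff_distrib[symmetric])
    also have "\<dots> \<le> x * (1 / v)"
      using harm_approx[OF \<open>u \<ge> 1\<close>] x1 unfolding v_def by (intro mult_left_mono) auto
    finally show ?thesis using x3 by simp
  qed
  \<comment> \<open>The cost of writing \<open>ln x\<close> for \<open>2 * ln v\<close>, from
    \<open>ln y \<le> y - 1\<close> at \<open>y = x / v\<^sup>2\<close>.\<close>
  have L: "0 \<le> x * (ln x - 2 * ln v)" "x * (ln x - 2 * ln v) \<le> 6 * v"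
  proof -
    have *: "ln x - 2 * ln v = ln (x / v\<^sup>2)" using v1 x1 by (simp add: ln_div ln_realpow)
    have "x / v\<^sup>2 \<ge> 1" using vx v1 by simp
    then show "0 \<le> x * (ln x - 2 * ln v)" unfolding * using x1 by simp
    have "ln (x / v\<^sup>2) \<le> x / v\<^sup>2 - 1" using x1 v1 by (intro ln_le_minus_one) auto
    also have "x / v\<^sup>2 \<le> (v\<^sup>2 + 2 * v) / v\<^sup>2" using xv by (rule divide_right_mono) simp
    also have "\<dots> - 1 = 2 / v" using v1 by (simp add: field_simps power2_eq_square)
    finally have "x * (ln x - 2 * ln v) \<le> x * (2 / v)" unfolding * using x1 by (intro mult_left_mono) auto
    also have "x * (2 / v) = 2 * (x / v)" by simp
    finally show "x * (ln x - 2 * ln v) \<le> 6 * v" using x3 by linarith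
  qed
  have "real (card (hyperbola_pairs n) + u\<^sup>2) = real (2 * (\<Sum>b=1..u. n div b))"
    using card_hyperbola_pairs_eq[of n] unfolding u_def by presburger
  then have "real (card (hyperbola_pairs n)) = 2 * A - v\<^sup>2" unfolding A_def v_def by simp
  then have "real (card (hyperbola_pairs n)) - dirichlet_main x
     = 2 * (A - x * harm u) + 2 * (x * harm u - x * (ln v + euler_mascheroni))
       - x * (ln x - 2 * ln v) + (x - v\<^sup>2)"
    unfolding dirichlet_main_def by (simp add: algebra_simps)
  \<comment> \<open>The four contributions are at most \<open>2 * v\<close>, \<open>6 * v\<close>,
    \<open>6 * v\<close> and \<open>2 * v\<close>, so 20 is generous.\<close>
  moreover have bound: "\<bar>z\<bar> \<le> 20 * v"
    if "z = 2 * p + 2 * q - r + (x - v\<^sup>2)" "\<bar>p\<bar> \<le> v" "\<bar>q\<bar> \<le> 3 * v" "0 \<le> r" "r \<le> 6 * v"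
    for z p q r :: real
    using that vx xv v1 by linarith
  ultimately have "\<bar>real (card (hyperbola_pairs n)) - dirichlet_main x\<bar> \<le> 20 * v"
    using bound[OF _ A H L] by blast
  also have "v \<le> sqrt x" using vx by (rule real_le_rsqrt)
  finally show ?thesis unfolding x_def by simp
qed

section \<open>Summation by parts over the hyperbola\<close>

lemma dirichlet_main_deriv:
  "t > 0 \<Longrightarrow> (dirichlet_main has_real_derivative ln t + 2 * euler_mascheroni) (at t)"
  unfolding dirichlet_main_def by (auto intro!: derivative_eq_intros)

text \<open>Since \<open>w\<close> is monotone, the bounds on the increments of the error
  telescope.\<close>
lemma sum_hyperbola_pairs_approx:
  fixes w F :: "real \<Rightarrow> real"
  assumes F: "\<And>t. t \<ge> 1 \<Longrightarrow> (F has_real_derivative (ln t + 2 * euler_mascheroni) * w t) (at t)"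
    and mono: "\<And>s t. 1 \<le> s \<Longrightarrow> s \<le> t \<Longrightarrow> w s \<le> w t"
    and w1: "w 1 = 0" and n: "n \<ge> 1"
  shows "\<bar>(\<Sum>(b, k)\<in>hyperbola_pairs n. w (real (b * k))) - (F (real n) - F 1)\<bar>
    \<le> (40 * sqrt (real n) + ln (real n) + 2 * euler_mascheroni) * w (real n)"
proof -
  define T where "T m = (\<Sum>(b, k)\<in>hyperbola_pairs m. w (real (b * k)))" for m
  define E where "E m = real (card (hyperbola_pairs m)) - dirichlet_main (real m)" for m
  \<comment> \<open>\<open>K\<close> bounds the divisor error up to \<open>n\<close>;
    \<open>L\<close> is the slope of \<open>dirichlet_main\<close> at \<open>n\<close>, which bounds
    its unit increments up to there.\<close>
  define K where "K = 20 * sqrt (real n)"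
  define L where "L = ln (real n) + 2 * euler_mascheroni"
  have E: "\<bar>E m\<bar> \<le> K" if "1 \<le> m" "m \<le> n" for m
  proof -
    have "\<bar>E m\<bar> \<le> 20 * sqrt (real m)"
      unfolding E_def by (rule dirichlet_divisor_bound[OF that(1)])
    also have "\<dots> \<le> K" unfolding K_def using that by simp
    finally show ?thesis .
  qed
  \<comment> \<open>With the boundary term \<open>E m * w m\<close> split off, each step costs at
    most \<open>K + L\<close> times an increment of \<open>w\<close>; these add up to
    \<open>w m\<close> since \<open>w 1 = 0\<close>.\<close>
  have main: "\<bar>T m - (F (real m) - F 1) - E m * w (real m)\<bar> \<le> (K + L) * w (real m)"
    if "1 \<le> m" "m \<le> n" for m
    using that
  proof (induction m rule: dec_induct)
    case base
    have "hyperbola_pairs 1 = {(1, 1)}"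
      by (auto simp: hyperbola_pairs_eq_Sigma)
    then show ?case unfolding T_def using w1 by simp
  next
    case (step m)
    define s where "s = real m"
    have s: "s \<ge> 1" using step unfolding s_def by simp
    define d where "d = dirichlet_main (s + 1) - dirichlet_main s"
    have lnp: "ln t + 2 * euler_mascheroni \<ge> 0" if "t \<ge> 1" for t :: real
      using that euler_mascheroni_pos by (smt (verit) ln_ge_zero)
    have "dirichlet_main s \<le> dirichlet_main (s + 1)"
      by (rule DERIV_nonneg_imp_nondecreasing)
        (use s lnp in \<open>auto intro!: exI dirichlet_main_deriv\<close>)
    then have d0: "d \<ge> 0" unfolding d_def by simp
    have "L * s - dirichlet_main s \<le> L * (s + 1) - dirichlet_main (s + 1)"
    proof (rule DERIV_nonneg_imp_nondecreasing[where f = "\<lambda>t. L * t - dirichlet_main t"])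
      fix t assume t: "s \<le> t" "t \<le> s + 1"
      have "t \<le> real n" using t step unfolding s_def by linarith
      then have "ln t \<le> ln (real n)" using t s by (subst ln_le_cancel_iff) auto
      then have "0 \<le> L - (ln t + 2 * euler_mascheroni)" unfolding L_def by simp
      moreover have "((\<lambda>t. L * t - dirichlet_main t) has_real_derivative
          L - (ln t + 2 * euler_mascheroni)) (at t)"
        using t s by (auto intro!: derivative_eq_intros dirichlet_main_deriv)
      ultimately show "\<exists>y. ((\<lambda>t. L * t - dirichlet_main t) has_real_derivative y) (at t) \<and> 0 \<le> y"
        by blast
    qed simp
    then have dL: "d \<le> L" unfolding d_def by (simp add: algebra_simps)
    \<comment> \<open>On the interval from \<open>s\<close> to \<open>s + 1\<close> the slope of
      \<open>F\<close> is that of \<open>dirichlet_main\<close> times \<open>w t\<close>, and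
      \<open>w t\<close> lies between \<open>w s\<close> and \<open>w (s + 1)\<close>. Monotone
      auxiliary functions take the place of integrals.\<close>
    have "w (s + 1) * dirichlet_main s - F s \<le> w (s + 1) * dirichlet_main (s + 1) - F (s + 1)"
    proof (rule DERIV_nonneg_imp_nondecreasing[where f = "\<lambda>t. w (s + 1) * dirichlet_main t - F t"])
      fix t assume t: "s \<le> t" "t \<le> s + 1"
      have "0 \<le> (ln t + 2 * euler_mascheroni) * (w (s + 1) - w t)"
        using t s lnp mono by (intro mult_nonneg_nonneg) auto
      moreover have "((\<lambda>t. w (s + 1) * dirichlet_main t - F t) has_real_derivative
          (ln t + 2 * euler_mascheroni) * (w (s + 1) - w t)) (at t)"
        using t s by (auto intro!: derivative_eq_intros dirichlet_main_deriv F simp: algebra_simps)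
      ultimately show "\<exists>y. ((\<lambda>t. w (s + 1) * dirichlet_main t - F t) has_real_derivative y) (at t) \<and> 0 \<le> y"
        by blast
    qed simp
    then have up: "F (s + 1) - F s \<le> w (s + 1) * d" unfolding d_def by (simp add: algebra_simps)
    have "F s - w s * dirichlet_main s \<le> F (s + 1) - w s * dirichlet_main (s + 1)"
    proof (rule DERIV_nonneg_imp_nondecreasing[where f = "\<lambda>t. F t - w s * dirichlet_main t"])
      fix t assume t: "s \<le> t" "t \<le> s + 1"
      have "0 \<le> (ln t + 2 * euler_mascheroni) * (w t - w s)"
        using t s lnp mono by (intro mult_nonneg_nonneg) auto
      moreover have "((\<lambda>t. F t - w s * dirichlet_main t) has_real_derivative
          (ln t + 2 * euler_mascheroni) * (w t - w s)) (at t)"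
        using t s by (auto intro!: derivative_eq_intros dirichlet_main_deriv F simp: algebra_simps)
      ultimately show "\<exists>y. ((\<lambda>t. F t - w s * dirichlet_main t) has_real_derivative y) (at t) \<and> 0 \<le> y"
        by blast
    qed simp
    then have lo: "w s * d \<le> F (s + 1) - F s" unfolding d_def by (simp add: algebra_simps)
    define \<delta> where "\<delta> = w (s + 1) - w s"
    have \<delta>: "\<delta> \<ge> 0" unfolding \<delta>_def using mono s by simp
    have T: "T (Suc m) = T m + (d + E (Suc m) - E m) * w (s + 1)"
      unfolding T_def E_def d_def s_def
      using sum_hyperbola_pairs_Suc[of "\<lambda>j. w (real j)" m] by (simp add: add.commute)
    have "\<bar>E m * \<delta>\<bar> \<le> K * \<delta>"
      using E[of m] step \<delta> by (simp add: abs_mult mult_right_mono)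
    moreover have "d * \<delta> \<le> L * \<delta>" using dL \<delta> by (rule mult_right_mono)
    moreover have "0 \<le> w (s + 1) * d - (F (s + 1) - F s)" using up by simp
    moreover have "w (s + 1) * d - (F (s + 1) - F s) \<le> d * \<delta>"
      using lo unfolding \<delta>_def by (simp add: algebra_simps)
    ultimately have inc: "\<bar>w (s + 1) * d - (F (s + 1) - F s) - E m * \<delta>\<bar> \<le> K * \<delta> + L * \<delta>"
      by linarith
    \<comment> \<open>Summation by parts: \<open>E (Suc m)\<close> drops out and \<open>E m\<close>
      survives only against the increment of \<open>w\<close>.\<close>
    have "T (Suc m) - (F (s + 1) - F 1) - E (Suc m) * w (s + 1)
      = (T m - (F s - F 1) - E m * w s) + (w (s + 1) * d - (F (s + 1) - F s) - E m * \<delta>)"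
      unfolding T \<delta>_def by (simp add: algebra_simps)
    moreover have "\<bar>T m - (F s - F 1) - E m * w s\<bar> \<le> (K + L) * w s"
      using step unfolding s_def by simp
    moreover have "(K + L) * w (s + 1) = (K + L) * w s + (K * \<delta> + L * \<delta>)"
      unfolding \<delta>_def by (simp add: algebra_simps)
    ultimately have "\<bar>T (Suc m) - (F (s + 1) - F 1) - E (Suc m) * w (s + 1)\<bar> \<le> (K + L) * w (s + 1)"
      using inc by linarith
    then show ?case unfolding s_def by (simp add: add.commute)
  qed
  have wn: "w (real n) \<ge> 0" using mono[of 1 "real n"] n w1 by simp
  have En: "\<bar>E n * w (real n)\<bar> \<le> K * w (real n)"
    using E[of n] n wn by (simp add: abs_mult mult_right_mono)
  have tri: "\<bar>a\<bar> \<le> P + Q" if "\<bar>a - b\<bar> \<le> P" "\<bar>b\<bar> \<le> Q" for a b P Q :: real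
    using that by linarith
  \<comment> \<open>Restoring the boundary term costs \<open>K\<close> once more, which turns 20
    into 40.\<close>
  have "\<bar>T n - (F (real n) - F 1)\<bar> \<le> (K + L) * w (real n) + K * w (real n)"
    by (rule tri[OF main[OF n order.refl] En])
  then show ?thesis unfolding T_def K_def L_def by (simp add: algebra_simps)
qed

section \<open>Evaluation of the first-power sum\<close>

text \<open>Each \<open>legendre_term n b\<close> unfolds into its arithmetic progression over
  \<open>k\<close>. The factor besides \<open>ln b\<close> depends only on \<open>b * k\<close>, so
  averaging with the swapped sum turns \<open>ln b\<close> into half of
  \<open>ln (b * k)\<close>.\<close>

lemma sum_ln_legendre_term_eq:
  "(\<Sum>b=1..n. ln (real b) * legendre_term n b)
   = (\<Sum>(b, k)\<in>hyperbola_pairs n. real (b * k) * ln (real (b * k)))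
     - (real n + 1) / 2 * (\<Sum>(b, k)\<in>hyperbola_pairs n. ln (real (b * k)))"
proof -
  define g where "g b k = ln (real b) * (2 * real (b * k) - (real n + 1))" for b k :: nat
  have gauss: "(\<Sum>k=1..q. 2 * real (b * k) - c) = real q * (real b * (real q + 1) - c)" for q b c
    by (induction q) (simp_all add: algebra_simps)
  have "(\<Sum>b=1..n. ln (real b) * legendre_term n b) = (\<Sum>b=1..n. \<Sum>k=1..n div b. g b k)"
    unfolding g_def sum_distrib_left[symmetric] gauss legendre_term_def ..
  also have "\<dots> = (\<Sum>(b, k)\<in>hyperbola_pairs n. g b k)"
    unfolding hyperbola_pairs_eq_Sigma by (rule sum.Sigma) auto
  finally have 1: "(\<Sum>b=1..n. ln (real b) * legendre_term n b) = (\<Sum>(b, k)\<in>hyperbola_pairs n. g b k)" .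
  have "2 * (\<Sum>(b, k)\<in>hyperbola_pairs n. g b k)
      = (\<Sum>(b, k)\<in>hyperbola_pairs n. g b k) + (\<Sum>(b, k)\<in>hyperbola_pairs n. g k b)"
    using sum_hyperbola_pairs_swap[of g n] by simp
  also have "\<dots> = (\<Sum>(b, k)\<in>hyperbola_pairs n.
      2 * (real (b * k) * ln (real (b * k))) - (real n + 1) * ln (real (b * k)))"
    unfolding sum.distrib[symmetric]
    by (rule sum.cong) (auto simp: hyperbola_pairs_def g_def ln_mult algebra_simps)
  also have "\<dots> = 2 * (\<Sum>(b, k)\<in>hyperbola_pairs n. real (b * k) * ln (real (b * k)))
      - (real n + 1) * (\<Sum>(b, k)\<in>hyperbola_pairs n. ln (real (b * k)))"
    by (simp add: case_prod_unfold sum_subtractf sum_distrib_left)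
  finally show ?thesis unfolding 1 by (simp add: field_simps)
qed

text \<open>This and the next function are antiderivatives of the weights \<open>ln t\<close> and
  \<open>t * ln t\<close> times the slope \<open>ln t + 2 * euler_mascheroni\<close> of
  \<open>dirichlet_main\<close>.\<close>

definition ln_primitive :: "real \<Rightarrow> real" where
  "ln_primitive t = t * (ln t)\<^sup>2 - 2 * t * ln t + 2 * t + 2 * euler_mascheroni * (t * ln t - t)"

definition id_ln_primitive :: "real \<Rightarrow> real" where
  "id_ln_primitive t = t\<^sup>2 / 2 * (ln t)\<^sup>2 - t\<^sup>2 / 2 * ln t + t\<^sup>2 / 4 + euler_mascheroni * (t\<^sup>2 * ln t - t\<^sup>2 / 2)"

lemma ln_primitive_deriv: "t > 0 \<Longrightarrow> (ln_primitive has_real_derivative (ln t + 2 * euler_mascheroni) * ln t) (at t)"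
  unfolding ln_primitive_def
  by (auto intro!: derivative_eq_intros simp: field_simps power2_eq_square)

lemma id_ln_primitive_deriv: "t > 0 \<Longrightarrow> (id_ln_primitive has_real_derivative (ln t + 2 * euler_mascheroni) * (t * ln t)) (at t)"
  unfolding id_ln_primitive_def
  by (auto intro!: derivative_eq_intros simp: field_simps power2_eq_square)

lemma sum_ln_legendre_term_approx:
  assumes "n \<ge> 2"
  shows "\<bar>(\<Sum>b=1..n. ln (real b) * legendre_term n b)
       - (1 / 2 * real n ^ 2 * ln (real n) + (1 / 2 * euler_mascheroni - 3 / 4) * real n ^ 2)\<bar>
    \<le> 200 * (real n * sqrt (real n) * ln (real n))"
proof -
  define x where "x = real n"
  define r where "r = sqrt x"
  define L where "L = ln x"
  define c where "c = (euler_mascheroni :: real)"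
  define T0 where "T0 = (\<Sum>(b, k)\<in>hyperbola_pairs n. ln (real (b * k)))"
  define T1 where "T1 = (\<Sum>(b, k)\<in>hyperbola_pairs n. real (b * k) * ln (real (b * k)))"
  define e where "e = (40 * r + L + 2 * c) * L"
  have x: "x \<ge> 2" unfolding x_def using assms by simp
  have r: "r \<ge> 1" unfolding r_def using x by simp
  have rr: "r * r = x" unfolding r_def using x by simp
  have c: "0 < c" "c < 1" unfolding c_def using euler_mascheroni_pos euler_mascheroni_less_13_over_22 by auto
  \<comment> \<open>A positive lower bound on the logarithm lets constants be absorbed into the
    error term.\<close>
  have L0: "L \<ge> 1 / 2"
  proof -
    have "ln 2 \<le> L" unfolding L_def using x by simp
    then show ?thesis using ln2_ge_two_thirds by linarith
  qed
  have "L = 2 * ln r" unfolding L_def rr[symmetric] using r by (simp add: ln_mult)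
  then have L: "L \<le> 2 * r" using ln_le_minus_one[of r] r by linarith
  have "\<bar>T0 - (ln_primitive x - ln_primitive 1)\<bar> \<le> e"
    unfolding T0_def e_def x_def r_def L_def c_def
    by (rule sum_hyperbola_pairs_approx) (use assms in \<open>auto intro!: ln_primitive_deriv\<close>)
  then have T0: "\<bar>T0 - (ln_primitive x - (2 - 2 * c))\<bar> \<le> e" by (simp add: ln_primitive_def c_def)
  have "\<bar>T1 - (id_ln_primitive x - id_ln_primitive 1)\<bar> \<le> (40 * r + L + 2 * c) * (x * L)"
    unfolding T1_def x_def r_def L_def c_def
    by (rule sum_hyperbola_pairs_approx) (use assms in \<open>auto intro!: id_ln_primitive_deriv mult_mono\<close>)
  then have T1: "\<bar>T1 - (id_ln_primitive x - (1 / 4 - c / 2))\<bar> \<le> x * e"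
    by (simp add: id_ln_primitive_def c_def e_def mult_ac)
  have "40 * r + L + 2 * c \<le> 44 * r" using L c r by linarith
  then have e: "e \<le> 44 * (r * L)" unfolding e_def using L0 by (simp add: mult_right_mono mult.assoc[symmetric])
  \<comment> \<open>A crude bound suffices: beyond the main term, \<open>ln_primitive x\<close>
    enters only through the extra 1 in \<open>(x + 1) / 2\<close>.\<close>
  have F0: "\<bar>ln_primitive x\<bar> \<le> 12 * (x * (r * L))"
  proof -
    have F: "ln_primitive x = x * (L * L - 2 * L + 2 + 2 * c * L - 2 * c)"
      unfolding ln_primitive_def L_def c_def by (simp add: power2_eq_square algebra_simps)
    have "L * L \<le> 2 * r * L" using L L0 by (intro mult_right_mono) auto
    then have "L * L \<le> 2 * (r * L)" by simp
    moreover have "1 * L \<le> r * L" using r L0 by (intro mult_right_mono) auto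
    moreover have "1 * (1 / 2) \<le> r * L" using r L0 by (intro mult_mono) auto
    moreover have "c * L \<le> 1 * L" using c L0 by (intro mult_right_mono) auto
    moreover have "0 \<le> c * L" using c L0 by simp
    moreover have "0 \<le> L * L" by simp
    moreover have "\<bar>P - 2 * L + 2 + 2 * Q - 2 * c\<bar> \<le> 12 * R"
      if "P \<le> 2 * R" "1 * L \<le> R" "1 * (1 / 2) \<le> R" "Q \<le> 1 * L" "0 \<le> Q" "0 \<le> P" for P Q R
      using that c L0 by linarith
    ultimately have "\<bar>L * L - 2 * L + 2 + 2 * (c * L) - 2 * c\<bar> \<le> 12 * (r * L)"
      by blast
    then have "\<bar>L * L - 2 * L + 2 + 2 * c * L - 2 * c\<bar> \<le> 12 * (r * L)" by (simp add: mult.assoc)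
    then have "x * \<bar>L * L - 2 * L + 2 + 2 * c * L - 2 * c\<bar> \<le> x * (12 * (r * L))"
      using x by (intro mult_left_mono) auto
    then show ?thesis unfolding F using x by (simp add: abs_mult)
  qed
  have xrL: "1 \<le> x * (r * L)" "x \<le> 2 * (x * (r * L))" "r * L \<le> x * (r * L)"
  proof -
    have a: "1 * (1/2) \<le> r * L" using r L0 by (intro mult_mono) auto
    then have "2 * (1 / 2) \<le> x * (r * L)" using x by (intro mult_mono) auto
    then show "1 \<le> x * (r * L)" by simp
    have "x * (1 / 2) \<le> x * (r * L)" using a x by (intro mult_left_mono) auto
    then show "x \<le> 2 * (x * (r * L))" by simp
    have "1 * (r * L) \<le> x * (r * L)" using a x by (intro mult_right_mono) auto
    then show "r * L \<le> x * (r * L)" by simp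
  qed
  have xe: "x * e \<le> 44 * (x * (r * L))" using e x by (simp add: mult_left_mono mult.left_commute)
  \<comment> \<open>The squared logarithms cancel here, and the main term of the theorem
    remains.\<close>
  have "id_ln_primitive x - x / 2 * ln_primitive x = 1 / 2 * x\<^sup>2 * L + (1 / 2 * c - 3 / 4) * x\<^sup>2"
    unfolding id_ln_primitive_def ln_primitive_def L_def c_def by (simp add: power2_eq_square field_simps)
  moreover have "(\<Sum>b=1..n. ln (real b) * legendre_term n b) = T1 - (x + 1) / 2 * T0"
    unfolding T0_def T1_def x_def by (rule sum_ln_legendre_term_eq)
  ultimately have eq: "(\<Sum>b=1..n. ln (real b) * legendre_term n b)
      - (1 / 2 * x\<^sup>2 * L + (1 / 2 * c - 3 / 4) * x\<^sup>2)
    = (T1 - (id_ln_primitive x - (1 / 4 - c / 2))) - x / 2 * (T0 - (ln_primitive x - (2 - 2 * c)))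
      - 1 / 2 * (T0 - (ln_primitive x - (2 - 2 * c))) - 1 / 2 * ln_primitive x + (1 - c) * (x + 1) - (1 / 4 - c / 2)"
    by (simp add: field_simps)
  have q: "\<bar>x / 2 * (T0 - (ln_primitive x - (2 - 2 * c)))\<bar> \<le> x * e / 2"
    unfolding abs_mult using x T0 by (simp add: mult_left_mono)
  have d: "0 \<le> (1 - c) * (x + 1)" "(1 - c) * (x + 1) \<le> x + 1"
    using c x mult_right_mono[of "1 - c" 1 "x + 1"] by simp_all
  \<comment> \<open>Products become variables, so linear arithmetic applies. The errors sum to less
    than \<open>(44 + 22 + 22 + 6 + 3 + 1) * y\<close>.\<close>
  have bound: "\<bar>z\<bar> \<le> 200 * y"
    if "z = p - q - 1 / 2 * s - 1 / 2 * f + d - (1 / 4 - c / 2)" "\<bar>q\<bar> \<le> X / 2" "0 \<le> d" "d \<le> x + 1"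
      "\<bar>p\<bar> \<le> X" "\<bar>s\<bar> \<le> e" "e \<le> 44 * w" "X \<le> 44 * y" "1 \<le> y" "x \<le> 2 * y" "w \<le> y" "\<bar>f\<bar> \<le> 12 * y"
    for z p q s f d X y w :: real
    using that c by linarith
  have "\<bar>(\<Sum>b=1..n. ln (real b) * legendre_term n b)
      - (1 / 2 * x\<^sup>2 * L + (1 / 2 * c - 3 / 4) * x\<^sup>2)\<bar> \<le> 200 * (x * (r * L))"
    by (rule bound[OF eq q d T1 T0 e xe xrL F0])
  then show ?thesis unfolding x_def r_def L_def c_def by (simp add: mult.assoc)
qed

theorem theorem1p1:
  shows "\<exists>C::real. \<forall>n::nat. n \<ge> 2 \<longrightarrow>
    \<bar>ln (G_bar_bar n)
       - (1 / 2 * real n ^ 2 * ln (real n) + (1 / 2 * euler_mascheroni - 3 / 4) * real n ^ 2)\<bar>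
    \<le> C * (real n powr (3 / 2) * ln (real n))"
proof (intro exI allI impI)
  fix n :: nat assume n: "n \<ge> 2"
  have "real n powr (3 / 2) = real n powr (1 + 1 / 2)" by simp
  also have "\<dots> = real n * sqrt (real n)"
    using n unfolding powr_add by (simp add: powr_half_sqrt)
  \<comment> \<open>The first powers contribute 200 and the higher powers 1.\<close>
  finally show "\<bar>ln (G_bar_bar n)
       - (1 / 2 * real n ^ 2 * ln (real n) + (1 / 2 * euler_mascheroni - 3 / 4) * real n ^ 2)\<bar>
    \<le> 201 * (real n powr (3 / 2) * ln (real n))"
    using sum_ln_legendre_term_approx[OF n] ln_G_bar_bar_approx[of n] n by simp
qed

end
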